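(* Let $G$ be a finite simple graph. (i) If $H$ is a graph obtained from $G$ by a sequence of $\alpha_v$ vertex deletions and $\alpha_e$ edge deletions, then \[ s(H)-\alpha_e\le s(G)\le s(H)+\alpha_v+\alpha_e. \] (ii) If $F$ is a graph obtained from $G$ by a sequence of $\beta_v$ vertex deletions, $\beta_e$ edge deletions and $\beta_c$ edge contractions, then \[ s(G)\le s(F)+\beta_v+\beta_e+2\beta_c. \] Moreover, both (i) and (ii) also hold with the strong boxicity $s(\cdot)$ replaced by the boxicity $b(\cdot)$ throughout.
   Context: Let $G=(V,E)$ be a graph with $V=\{1,\dots,n\}$. A rectangle in $\mathbb{R}^d$ is a closed set $A=\prod_{i=1}^d[a_i,b_i]$ with $a_i\le b_i$. Its interior is $A^0=\prod_{i=1}^d(a_i,b_i)$ and its boundary is $\partial A=A\setminus A^0$. For $x\in\mathbb{R}^d$ and $y>0$, let $B_d(x,y)=x+[-y/2,y/2]^d$. A family of rectangles $\{I_i\}_{1\le i\le n}$ in $\mathbb{R}^d$ ($d\ge1$) is a rectangular representation of $G$ if (c1) for all $i\ne j$, $I_i\cap I_j\ne\emptyset$ if and only if $(i,j)\in E$. It is a strong rectangular representation if in addition (c2) for every vertex $v$ there exist a point $x_v\in\partial I_v$ and a number $a_v>0$ such that $B_d(x_v,a_v)\subset\big(\bigcup_{u\ne v}I_u\big)^c$. The boxicity $b(G)$ is the smallest $d$ such that $G$ has a rectangular representation in $\mathbb{R}^d$. The strong boxicity $s(G)$ is the smallest $d$ such that $G$ has a strong rectangular representation in $\mathbb{R}^d$.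 A vertex deletion removes a vertex together with its incident edges. An edge deletion removes a single edge. Contracting an edge $(u,w)$ produces the graph in which $w$ is removed, all edges not incident to $w$ are kept, and $u$ is additionally made adjacent to every vertex of $N_G(w)\setminus\{u\}$. *)

theory Defs
  imports Complex_Main "HOL-Library.FuncSet" "Graph_Theory.Pair_Digraph"
begin

text \<open>
  Finite simple graphs are the symmetric loop-free digraphs of locale \<^locale>\<open>pair_graph\<close>:
  an undirected edge between \<open>u\<close> and \<open>w\<close> is the pair of arcs \<open>(u, w)\<close> and \<open>(w, u)\<close>.

  Since the dimension is minimised over, \<open>\<real>\<^sup>d\<close> cannot be a type indexed by \<open>d\<close>. It is the set of
  extensional functions \<open>{..<d} \<rightarrow>\<^sub>E UNIV\<close>, with coordinates indexed by \<open>0, \<dots>, d - 1\<close>.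
\<close>

definition rspace :: "nat \<Rightarrow> (nat \<Rightarrow> real) set" where
  "rspace d = ({..<d} \<rightarrow>\<^sub>E UNIV)"

definition rect :: "nat \<Rightarrow> (nat \<Rightarrow> real) \<Rightarrow> (nat \<Rightarrow> real) \<Rightarrow> (nat \<Rightarrow> real) set" where
  "rect d a b = (\<Pi>\<^sub>E i\<in>{..<d}. {a i..b i})"

definition rect_interior :: "nat \<Rightarrow> (nat \<Rightarrow> real) \<Rightarrow> (nat \<Rightarrow> real) \<Rightarrow> (nat \<Rightarrow> real) set" where
  "rect_interior d a b = (\<Pi>\<^sub>E i\<in>{..<d}. {a i<..<b i})"

definition rect_boundary :: "nat \<Rightarrow> (nat \<Rightarrow> real) \<Rightarrow> (nat \<Rightarrow> real) \<Rightarrow> (nat \<Rightarrow> real) set" where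
  "rect_boundary d a b = rect d a b - rect_interior d a b"

text \<open>The cube \<open>x + [-y/2, y/2]\<^sup>d\<close>; the side length is \<open>y\<close>, not \<open>2 y\<close>.\<close>

definition cube :: "nat \<Rightarrow> (nat \<Rightarrow> real) \<Rightarrow> real \<Rightarrow> (nat \<Rightarrow> real) set" where
  "cube d x y = (\<Pi>\<^sub>E i\<in>{..<d}. {x i - y / 2..x i + y / 2})"

text \<open>
  A family of rectangles is given by its families \<open>a\<close>, \<open>b\<close> of lower and upper corners, so the
  rectangle of the vertex \<open>v\<close> is \<open>rect d (a v) (b v)\<close>; only the coordinates below \<open>d\<close> matter.
  Degenerate rectangles are allowed.
\<close>

definition rect_rep ::
    "nat \<Rightarrow> 'v pair_pre_digraph \<Rightarrow> ('v \<Rightarrow> nat \<Rightarrow> real) \<Rightarrow> ('v \<Rightarrow> nat \<Rightarrow> real) \<Rightarrow> bool" where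
  "rect_rep d G a b \<longleftrightarrow>
     1 \<le> d \<and>
     (\<forall>v\<in>pverts G. \<forall>i<d. a v i \<le> b v i) \<and>
     (\<forall>u\<in>pverts G. \<forall>v\<in>pverts G. u \<noteq> v \<longrightarrow>
        (rect d (a u) (b u) \<inter> rect d (a v) (b v) \<noteq> {} \<longleftrightarrow> (u, v) \<in> parcs G))"

definition strong_rect_rep ::
    "nat \<Rightarrow> 'v pair_pre_digraph \<Rightarrow> ('v \<Rightarrow> nat \<Rightarrow> real) \<Rightarrow> ('v \<Rightarrow> nat \<Rightarrow> real) \<Rightarrow> bool" where
  "strong_rect_rep d G a b \<longleftrightarrow>
     rect_rep d G a b \<and>
     (\<forall>v\<in>pverts G. \<exists>x\<in>rect_boundary d (a v) (b v). \<exists>y>0.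
        cube d x y \<subseteq> rspace d - (\<Union>u\<in>pverts G - {v}. rect d (a u) (b u)))"

definition boxicity :: "'v pair_pre_digraph \<Rightarrow> nat" where
  "boxicity G = (LEAST d. \<exists>a b. rect_rep d G a b)"

definition strong_boxicity :: "'v pair_pre_digraph \<Rightarrow> nat" where
  "strong_boxicity G = (LEAST d. \<exists>a b. strong_rect_rep d G a b)"

definition delete_vertex :: "'v pair_pre_digraph \<Rightarrow> 'v \<Rightarrow> 'v pair_pre_digraph" where
  "delete_vertex G v =
     \<lparr>pverts = pverts G - {v}, parcs = {(x, y) \<in> parcs G. x \<noteq> v \<and> y \<noteq> v}\<rparr>"

definition delete_edge :: "'v pair_pre_digraph \<Rightarrow> 'v \<Rightarrow> 'v \<Rightarrow> 'v pair_pre_digraph" where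
  "delete_edge G u w = \<lparr>pverts = pverts G, parcs = parcs G - {(u, w), (w, u)}\<rparr>"

definition neighbours :: "'v pair_pre_digraph \<Rightarrow> 'v \<Rightarrow> 'v set" where
  "neighbours G w = {x. (w, x) \<in> parcs G}"

text \<open>Contraction is oriented: \<open>w\<close> is merged into \<open>u\<close>, which keeps its name.\<close>

definition contract_edge :: "'v pair_pre_digraph \<Rightarrow> 'v \<Rightarrow> 'v \<Rightarrow> 'v pair_pre_digraph" where
  "contract_edge G u w =
     \<lparr>pverts = pverts G - {w},
      parcs = {(x, y) \<in> parcs G. x \<noteq> w \<and> y \<noteq> w}
        \<union> {u} \<times> (neighbours G w - {u}) \<union> (neighbours G w - {u}) \<times> {u}\<rparr>"

text \<open>
  \<open>reduces_to G k l m H\<close>: some sequence of operations, in any order, consisting of exactly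
  \<open>k\<close> vertex deletions, \<open>l\<close> edge deletions and \<open>m\<close> edge contractions turns \<open>G\<close> into \<open>H\<close>.
\<close>

inductive reduces_to ::
    "'v pair_pre_digraph \<Rightarrow> nat \<Rightarrow> nat \<Rightarrow> nat \<Rightarrow> 'v pair_pre_digraph \<Rightarrow> bool"
  for G :: "'v pair_pre_digraph" where
  refl: "reduces_to G 0 0 0 G"
| del_vertex: "reduces_to G k l m H \<Longrightarrow> v \<in> pverts H \<Longrightarrow>
    reduces_to G (Suc k) l m (delete_vertex H v)"
| del_edge: "reduces_to G k l m H \<Longrightarrow> (u, w) \<in> parcs H \<Longrightarrow>
    reduces_to G k (Suc l) m (delete_edge H u w)"
| contract: "reduces_to G k l m H \<Longrightarrow> (u, w) \<in> parcs H \<Longrightarrow>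
    reduces_to G k l (Suc m) (contract_edge H u w)"

end

theory Submission
  imports Defs
begin

text \<open>
  Deleting a vertex does not increase either parameter and lowers it by at most 1: given a
  representation of \<open>G - v\<close>, the vertex \<open>v\<close> gets a box that is huge in the old coordinates and
  \<open>[-1, 0]\<close> in a new one, where its neighbours get \<open>[0, 1]\<close> and all other vertices \<open>[1, 1]\<close>. In the
  strong case the old exposed points are lifted to height 1, and \<open>v\<close> is exposed at height \<open>-1\<close>.
  The other two operations reduce to this one, since \<open>G\<close> and \<open>G - uw\<close> agree after deletion of \<open>u\<close>,
  and deleting \<open>u\<close> from \<open>G / uw\<close> is the same as deleting both \<open>u\<close> and \<open>w\<close> from \<open>G\<close>.
  Iterating the construction from the empty graph shows that strong representations exist, so no
  \<open>LEAST\<close> is taken over an empty predicate.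
\<close>

section \<open>Operations on simple graphs\<close>

lemma pair_graphI:
  assumes "finite (pverts G)" "parcs G \<subseteq> pverts G \<times> pverts G"
    and "\<And>x. (x, x) \<notin> parcs G" "sym (parcs G)"
  shows "pair_graph G"
proof -
  have "finite (parcs G)"
    using assms(1,2) by (meson finite_SigmaI finite_subset)
  moreover have "symmetric (with_proj G)"
    using assms(4) by (simp add: symmetric_def arcs_ends_def arc_to_ends_def)
  ultimately show ?thesis
    using assms(1-3) by unfold_locales auto
qed

lemma pair_graphD:
  assumes "pair_graph G"
  shows "finite (pverts G)" "parcs G \<subseteq> pverts G \<times> pverts G"
    and "\<And>x. (x, x) \<notin> parcs G" "sym (parcs G)"
proof -
  interpret pair_graph G by (fact assms)
  show "finite (pverts G)" by (fact pair_finite_verts)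
  show "parcs G \<subseteq> pverts G \<times> pverts G"
    using arc_fst_in_verts arc_snd_in_verts by fastforce
  show "\<And>x. (x, x) \<notin> parcs G"
    using pair_no_loops by fastforce
  show "sym (parcs G)"
    using arcs_symmetric by (auto intro: symI)
qed

lemma pair_graph_delete_vertex:
  assumes "pair_graph G"
  shows "pair_graph (delete_vertex G v)"
  using pair_graphD[OF assms]
  by (intro pair_graphI) (auto simp: delete_vertex_def sym_def)

lemma pair_graph_delete_edge:
  assumes "pair_graph G"
  shows "pair_graph (delete_edge G u w)"
  using pair_graphD[OF assms]
  by (intro pair_graphI) (auto simp: delete_edge_def sym_def)

lemma pair_graph_contract_edge:
  assumes "pair_graph G" "(u, w) \<in> parcs G"
  shows "pair_graph (contract_edge G u w)"
  using pair_graphD[OF assms(1)] assms(2)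
  by (intro pair_graphI) (auto simp: contract_edge_def neighbours_def sym_def)

lemma delete_vertex_delete_edge: "delete_vertex (delete_edge G u w) u = delete_vertex G u"
  by (auto simp: delete_vertex_def delete_edge_def)

text \<open>Every arc that the contraction adds has \<open>u\<close> as an endpoint, so all of them
  vanish with \<open>u\<close>.\<close>

lemma delete_vertex_contract_edge:
  "delete_vertex (contract_edge G u w) u = delete_vertex (delete_vertex G w) u"
  by (auto simp: delete_vertex_def contract_edge_def)

lemma pair_graph_reduces_to:
  assumes "reduces_to G k l m H" "pair_graph G"
  shows "pair_graph H"
  using assms
  by induction (auto intro: pair_graph_delete_vertex pair_graph_delete_edge pair_graph_contract_edge)

section \<open>Parameters stable under vertex deletion\<close>

text \<open>Both (i) and (ii) follow from these two inequalities alone, so the strong and the plain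
  parameter are treated together as two interpretations.\<close>

locale vertex_stable =
  fixes f :: "'v pair_pre_digraph \<Rightarrow> nat"
  assumes delete_le: "pair_graph G \<Longrightarrow> v \<in> pverts G \<Longrightarrow> f (delete_vertex G v) \<le> f G"
    and le_delete: "pair_graph G \<Longrightarrow> v \<in> pverts G \<Longrightarrow> f G \<le> f (delete_vertex G v) + 1"
begin

text \<open>Both graphs are compared with their common subgraph without \<open>u\<close>: going down
  to it costs nothing and coming back up costs 1.\<close>

lemma delete_edge_bounds:
  assumes G: "pair_graph G" and uw: "(u, w) \<in> parcs G"
  shows "f (delete_edge G u w) \<le> f G + 1" "f G \<le> f (delete_edge G u w) + 1"
proof -
  have u: "u \<in> pverts G" "u \<in> pverts (delete_edge G u w)"
    using pair_graphD(2)[OF G] uw by (auto simp: delete_edge_def)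
  note G' = pair_graph_delete_edge[OF G, of u w]
  show "f (delete_edge G u w) \<le> f G + 1" "f G \<le> f (delete_edge G u w) + 1"
    using delete_le[OF G u(1)] le_delete[OF G u(1)] delete_le[OF G' u(2)] le_delete[OF G' u(2)]
    by (simp_all add: delete_vertex_delete_edge)
qed

text \<open>Restoring \<open>u\<close> and then \<open>w\<close> costs 2, starting from
  \<open>G\<close> without \<open>u\<close> and \<open>w\<close>; this graph is also the contraction
  without \<open>u\<close>, so its value is at most that of the contraction.\<close>

lemma le_contract_edge:
  assumes G: "pair_graph G" and uw: "(u, w) \<in> parcs G"
  shows "f G \<le> f (contract_edge G u w) + 2"
proof -
  have "w \<in> pverts G" "u \<in> pverts (delete_vertex G w)" "u \<in> pverts (contract_edge G u w)"
    using pair_graphD(2,3)[OF G] uw by (auto simp: delete_vertex_def contract_edge_def)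
  then show ?thesis
    using le_delete[OF G] le_delete[OF pair_graph_delete_vertex[OF G]]
      delete_le[OF pair_graph_contract_edge[OF G uw]]
    by (fastforce simp: delete_vertex_contract_edge)
qed

lemma reduces_to_upper:
  assumes "reduces_to G k l m H" "pair_graph G"
  shows "f G \<le> f H + k + l + 2 * m"
  using assms
proof induction
  case refl
  then show ?case by simp
next
  case (del_vertex k l m H v)
  then show ?case
    using le_delete[of H v] pair_graph_reduces_to[of G k l m H] by simp
next
  case (del_edge k l m H u w)
  then show ?case
    using delete_edge_bounds(2)[of H u w] pair_graph_reduces_to[of G k l m H] by simp
next
  case (contract k l m H u w)
  then show ?case
    using le_contract_edge[of H u w] pair_graph_reduces_to[of G k l m H] by simp
qed

lemma reduces_to_lower:
  assumes "reduces_to G k l 0 H" "pair_graph G"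
  shows "f H \<le> f G + l"
proof -
  \<comment> \<open>The literal 0 becomes a variable with an equation, so that the induction rule
    applies; the contraction case then contradicts \<open>Suc m = 0\<close>.\<close>
  have "f H \<le> f G + l" if "reduces_to G k l m H" "m = 0" for m
    using that
  proof induction
    case refl
    then show ?case by simp
  next
    case (del_vertex k l m H v)
    then show ?case
      using delete_le[of H v] pair_graph_reduces_to[of G k l m H] assms(2) by simp
  next
    case (del_edge k l m H u w)
    then show ?case
      using delete_edge_bounds(1)[of H u w] pair_graph_reduces_to[of G k l m H] assms(2) by simp
  qed simp
  with assms(1) show ?thesis by blast
qed

end

section \<open>Representations and vertex deletion\<close>

text \<open>The intersection of two boxes is the product of the coordinatewise intersections, and a
  product is nonempty exactly when all its factors are.\<close>

lemma rect_Int_nonempty_iff: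
  assumes "\<And>i. i < d \<Longrightarrow> a i \<le> b i" "\<And>i. i < d \<Longrightarrow> a' i \<le> b' i"
  shows "rect d a b \<inter> rect d a' b' \<noteq> {} \<longleftrightarrow> (\<forall>i<d. a i \<le> b' i \<and> a' i \<le> b i)"
proof -
  have "{a i..b i} \<inter> {a' i..b' i} \<noteq> {} \<longleftrightarrow> a i \<le> b' i \<and> a' i \<le> b i" if "i < d" for i
    using assms that by (auto simp: not_less)
  then show ?thesis
    unfolding rect_def PiE_Int PiE_eq_empty_iff by auto
qed

lemma rect_rep_iff:
  "rect_rep d G a b \<longleftrightarrow>
     1 \<le> d \<and>
     (\<forall>v\<in>pverts G. \<forall>i<d. a v i \<le> b v i) \<and>
     (\<forall>u\<in>pverts G. \<forall>v\<in>pverts G. u \<noteq> v \<longrightarrow>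
        ((\<forall>i<d. a u i \<le> b v i \<and> a v i \<le> b u i) \<longleftrightarrow> (u, v) \<in> parcs G))"
proof (cases "\<forall>v\<in>pverts G. \<forall>i<d. a v i \<le> b v i")
  case True
  then have "rect d (a u) (b u) \<inter> rect d (a v) (b v) \<noteq> {} \<longleftrightarrow>
      (\<forall>i<d. a u i \<le> b v i \<and> a v i \<le> b u i)" if "u \<in> pverts G" "v \<in> pverts G" for u v
    using that by (intro rect_Int_nonempty_iff) auto
  then show ?thesis
    unfolding rect_rep_def by simp
qed (auto simp: rect_rep_def)

lemma rect_rep_delete_vertex: "rect_rep d G a b \<Longrightarrow> rect_rep d (delete_vertex G v) a b"
  by (simp add: rect_rep_def delete_vertex_def)

text \<open>The old points and cubes still serve: the union that the cubes must avoid only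
  shrinks.\<close>

lemma strong_rect_rep_delete_vertex:
  assumes "strong_rect_rep d G a b"
  shows "strong_rect_rep d (delete_vertex G v) a b"
proof -
  have "\<exists>x\<in>rect_boundary d (a u) (b u). \<exists>y>0.
      cube d x y \<subseteq> rspace d - (\<Union>t\<in>pverts (delete_vertex G v) - {u}. rect d (a t) (b t))"
    if "u \<in> pverts (delete_vertex G v)" for u
  proof -
    have "u \<in> pverts G" using that by (simp add: delete_vertex_def)
    then obtain x y where "x \<in> rect_boundary d (a u) (b u)" "y > 0"
      "cube d x y \<subseteq> rspace d - (\<Union>t\<in>pverts G - {u}. rect d (a t) (b t))"
      using assms unfolding strong_rect_rep_def by blast
    moreover have "pverts (delete_vertex G v) \<subseteq> pverts G"
      by (auto simp: delete_vertex_def)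
    ultimately show ?thesis by blast
  qed
  moreover have "rect_rep d (delete_vertex G v) a b"
    using assms unfolding strong_rect_rep_def by (intro rect_rep_delete_vertex) (rule conjunct1)
  ultimately show ?thesis
    unfolding strong_rect_rep_def by (intro conjI ballI)
qed

section \<open>Adding a vertex at the cost of one dimension\<close>

definition ext_lower :: "nat \<Rightarrow> 'v pair_pre_digraph \<Rightarrow> 'v \<Rightarrow> ('v \<Rightarrow> nat \<Rightarrow> real) \<Rightarrow>
    (nat \<Rightarrow> real) \<Rightarrow> 'v \<Rightarrow> nat \<Rightarrow> real" where
  "ext_lower d G v a M u i =
     (if i < d then if u = v then - M i else a u i
      else if u = v then -1 else if (v, u) \<in> parcs G then 0 else 1)"

definition ext_upper :: "nat \<Rightarrow> 'v \<Rightarrow> ('v \<Rightarrow> nat \<Rightarrow> real) \<Rightarrow> (nat \<Rightarrow> real) \<Rightarrow> 'v \<Rightarrow> nat \<Rightarrow> real" where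
  "ext_upper d v b M u i =
     (if i < d then if u = v then M i else b u i else if u = v then 0 else 1)"

text \<open>A sum instead of a maximum stays meaningful without vertices. The old corners of the new
  vertex are arbitrary; including them can only enlarge the bound.\<close>

definition corner_bound :: "'v pair_pre_digraph \<Rightarrow> ('v \<Rightarrow> nat \<Rightarrow> real) \<Rightarrow> ('v \<Rightarrow> nat \<Rightarrow> real) \<Rightarrow>
    nat \<Rightarrow> real" where
  "corner_bound G a b i = (\<Sum>u\<in>pverts G. \<bar>a u i\<bar> + \<bar>b u i\<bar>)"

text \<open>With \<open>M\<close> this bound, the first fact makes \<open>[-M, M]\<close> a valid
  interval, and the other two make it meet every old interval.\<close>

lemma corner_bound:
  assumes "finite (pverts G)"
  shows "0 \<le> corner_bound G a b i"
    and "u \<in> pverts G \<Longrightarrow> a u i \<le> corner_bound G a b i"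
    and "u \<in> pverts G \<Longrightarrow> - corner_bound G a b i \<le> b u i"
proof -
  show "0 \<le> corner_bound G a b i"
    unfolding corner_bound_def by (intro sum_nonneg) auto
  assume "u \<in> pverts G"
  then have "\<bar>a u i\<bar> + \<bar>b u i\<bar> \<le> corner_bound G a b i"
    unfolding corner_bound_def
    using assms by (intro member_le_sum[where f = "\<lambda>u. \<bar>a u i\<bar> + \<bar>b u i\<bar>"]) auto
  then show "a u i \<le> corner_bound G a b i" "- corner_bound G a b i \<le> b u i"
    by linarith+
qed

text \<open>The old coordinates never separate \<open>v\<close> from another vertex, so the new one
  decides: \<open>[-1, 0]\<close> touches \<open>[0, 1]\<close> at 0 and misses
  \<open>[1, 1]\<close>. All other vertices share the height 1, so the old coordinates still decide
  among them.\<close>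

lemma rect_rep_extend:
  fixes G :: "'v pair_pre_digraph"
  assumes G: "pair_graph G" and v: "v \<in> pverts G"
    and rep: "rect_rep d (delete_vertex G v) a b"
  defines "M \<equiv> corner_bound G a b"
  shows "rect_rep (Suc d) G (ext_lower d G v a M) (ext_upper d v b M)"
proof -
  note g = pair_graphD[OF G]
  note M = corner_bound[OF g(1), where a = a and b = b, folded M_def]
  have old: "a u i \<le> b u i" if "u \<in> pverts G" "u \<noteq> v" "i < d" for u i
    using rep that by (auto simp: rect_rep_iff delete_vertex_def)
  have old_arc: "(\<forall>i<d. a u i \<le> b t i \<and> a t i \<le> b u i) \<longleftrightarrow> (u, t) \<in> parcs G"
    if "u \<in> pverts G" "u \<noteq> v" "t \<in> pverts G" "t \<noteq> v" "u \<noteq> t" for u t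
    using rep that by (auto simp: rect_rep_iff delete_vertex_def)
  \<comment> \<open>\<open>ext_lower\<close> tests only the arc leaving \<open>v\<close>, while
    \<open>v\<close> may be the second vertex of a pair.\<close>
  have sym: "(x, y) \<in> parcs G \<longleftrightarrow> (y, x) \<in> parcs G" for x y
    using g(4) by (auto dest: symD)
  have valid: "ext_lower d G v a M u i \<le> ext_upper d v b M u i" if "u \<in> pverts G" "i < Suc d" for u i
    using old[of u i] M(1)[of i] that by (auto simp: ext_lower_def ext_upper_def)
  have arc: "(\<forall>i<Suc d. ext_lower d G v a M u i \<le> ext_upper d v b M t i \<and>
        ext_lower d G v a M t i \<le> ext_upper d v b M u i) \<longleftrightarrow> (u, t) \<in> parcs G"
    if "u \<in> pverts G" "t \<in> pverts G" "u \<noteq> t" for u t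
  proof -
    consider "u = v" | "t = v" | "u \<noteq> v" "t \<noteq> v" by blast
    then show ?thesis
    proof cases
      case 1
      with that show ?thesis
        using M(2)[of t] M(3)[of t] by (auto simp: ext_lower_def ext_upper_def less_Suc_eq)
    next
      case 2
      with that show ?thesis
        using M(2)[of u] M(3)[of u] sym[of u v]
        by (auto simp: ext_lower_def ext_upper_def less_Suc_eq)
    next
      case 3
      with old_arc[of u t] that show ?thesis
        by (auto simp: ext_lower_def ext_upper_def less_Suc_eq)
    qed
  qed
  show ?thesis
    unfolding rect_rep_iff using valid arc by simp
qed

lemma restrict_mem_rect:
  assumes "p \<in> rect (Suc d) a b"
  shows "restrict p {..<d} \<in> rect d a b"
  using assms by (auto simp: rect_def PiE_iff)

lemma strong_rect_rep_extend:
  fixes G :: "'v pair_pre_digraph"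
  assumes G: "pair_graph G" and v: "v \<in> pverts G"
    and rep: "strong_rect_rep d (delete_vertex G v) a b"
  defines "M \<equiv> corner_bound G a b"
  shows "strong_rect_rep (Suc d) G (ext_lower d G v a M) (ext_upper d v b M)"
proof -
  note g = pair_graphD[OF G]
  note M = corner_bound[OF g(1), where a = a and b = b, folded M_def]
  let ?a = "ext_lower d G v a M" and ?b = "ext_upper d v b M"
  have rect_old: "rect d (?a u) (?b u) = rect d (a u) (b u)" if "u \<noteq> v" for u
    using that unfolding rect_def ext_lower_def ext_upper_def by (intro PiE_cong) simp
  have cube_rspace: "cube (Suc d) x y \<subseteq> rspace (Suc d)" for x y
    by (auto simp: cube_def rspace_def PiE_iff)
  have "\<exists>x\<in>rect_boundary (Suc d) (?a u) (?b u). \<exists>y>0.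
      cube (Suc d) x y \<subseteq> rspace (Suc d) - (\<Union>t\<in>pverts G - {u}. rect (Suc d) (?a t) (?b t))"
    if u: "u \<in> pverts G" for u
  proof (cases "u = v")
    case True
    \<comment> \<open>The origin lies in the old extent of \<open>v\<close> since \<open>M\<close>
      is nonnegative, and height -1 puts \<open>x\<close> on the bottom face. A cube of side 1 rises
      only to -1/2, below every other box.\<close>
    define x where "x = (\<lambda>i\<in>{..<Suc d}. if i < d then 0 else - 1 :: real)"
    have "x \<in> rect (Suc d) (?a v) (?b v)"
      using M(1) by (auto simp: x_def rect_def ext_lower_def ext_upper_def)
    moreover have "x \<notin> rect_interior (Suc d) (?a v) (?b v)"
    proof
      assume "x \<in> rect_interior (Suc d) (?a v) (?b v)"
      then have "?a v d < x d" by (auto simp: rect_interior_def PiE_iff)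
      then show False by (simp add: x_def ext_lower_def)
    qed
    moreover have "p \<notin> rect (Suc d) (?a t) (?b t)" if "p \<in> cube (Suc d) x 1" "t \<noteq> v" for p t
    proof
      assume "p \<in> rect (Suc d) (?a t) (?b t)"
      then have "?a t d \<le> p d" by (auto simp: rect_def PiE_iff)
      moreover have "p d \<le> x d + 1 / 2" using that(1) by (auto simp: cube_def PiE_iff)
      ultimately show False
        using that(2) by (auto simp: x_def ext_lower_def split: if_splits)
    qed
    ultimately show ?thesis
      unfolding True rect_boundary_def using cube_rspace
      by (intro bexI[of _ x] exI[of _ 1]) (auto intro: subsetD[OF cube_rspace])
  next
    case False
    with u have "u \<in> pverts (delete_vertex G v)" by (simp add: delete_vertex_def)
    with rep obtain x y where x: "x \<in> rect_boundary d (a u) (b u)" and "y > 0"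
      and avoid: "cube d x y \<subseteq>
        rspace d - (\<Union>t\<in>pverts (delete_vertex G v) - {u}. rect d (a t) (b t))"
      unfolding strong_rect_rep_def by blast
    define z where "z = x(d := 1)"
    have "z \<in> rect (Suc d) (?a u) (?b u)"
      using x False
      by (auto simp: z_def rect_boundary_def rect_def PiE_iff extensional_def ext_lower_def
          ext_upper_def)
    moreover have "z \<notin> rect_interior (Suc d) (?a u) (?b u)"
    proof
      assume "z \<in> rect_interior (Suc d) (?a u) (?b u)"
      \<comment> \<open>Forgetting the last coordinate would make \<open>x\<close> an interior point
        of the old rectangle.\<close>
      then have "x i \<in> {a u i<..<b u i}" if "i < d" for i
        using that False
        by (auto simp: z_def rect_interior_def PiE_iff ext_lower_def ext_upper_def
            dest!: bspec[where x = i])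
      with x show False
        by (auto simp: rect_boundary_def rect_def rect_interior_def PiE_iff)
    qed
    \<comment> \<open>The side is at most 1, so the cube stays at height 1/2 or more, above the top
      0 of \<open>v\<close>. It is also at most \<open>y\<close>, so the projection of the cube
      stays in the old cube and avoids the other old rectangles.\<close>
    moreover have "p \<notin> rect (Suc d) (?a t) (?b t)"
      if p: "p \<in> cube (Suc d) z (min y 1)" and t: "t \<in> pverts G" "t \<noteq> u" for p t
    proof
      assume in_rect: "p \<in> rect (Suc d) (?a t) (?b t)"
      show False
      proof (cases "t = v")
        case True
        from in_rect have "p d \<le> ?b v d" by (auto simp: True rect_def PiE_iff)
        moreover have "z d - min y 1 / 2 \<le> p d" using p by (auto simp: cube_def PiE_iff)
        ultimately show False by (simp add: z_def ext_upper_def)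
      next
        case False
        have "restrict p {..<d} i \<in> {x i - y / 2..x i + y / 2}" if "i < d" for i
        proof -
          have "p i \<in> {z i - min y 1 / 2..z i + min y 1 / 2}"
            using p that by (auto simp: cube_def PiE_iff)
          then show ?thesis using that by (auto simp: z_def min_def split: if_splits)
        qed
        then have "restrict p {..<d} \<in> cube d x y" by (auto simp: cube_def PiE_iff)
        moreover have "restrict p {..<d} \<in> rect d (a t) (b t)"
          using restrict_mem_rect[OF in_rect] rect_old[OF False] by simp
        ultimately show False
          using avoid t False by (auto simp: delete_vertex_def)
      qed
    qed
    ultimately show ?thesis
      unfolding rect_boundary_def using cube_rspace \<open>y > 0\<close>
      by (intro bexI[of _ z] exI[of _ "min y 1"])
        (auto intro: subsetD[OF cube_rspace])
  qed
  moreover have "rect_rep d (delete_vertex G v) a b"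
    using rep unfolding strong_rect_rep_def by (rule conjunct1)
  then have "rect_rep (Suc d) G ?a ?b"
    unfolding M_def by (rule rect_rep_extend[OF G v])
  ultimately show ?thesis
    unfolding strong_rect_rep_def by (intro conjI ballI)
qed

section \<open>Existence of representations and passage to least dimensions\<close>

lemma strong_rect_rep_exists:
  assumes "pair_graph G"
  shows "\<exists>d a b. strong_rect_rep d G a b"
  using assms
proof (induction "card (pverts G)" arbitrary: G)
  case 0
  \<comment> \<open>Without vertices only the demand \<open>1 \<le> d\<close> remains, hence
    dimension 1.\<close>
  then have "strong_rect_rep 1 G (\<lambda>_ _. 0) (\<lambda>_ _. 0)"
    using pair_graphD(1)[OF "0.prems"] by (simp add: strong_rect_rep_def rect_rep_def)
  then show ?case by blast
next
  case (Suc n)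
  then obtain v where v: "v \<in> pverts G" by (metis card_eq_SucD insertI1)
  have "n = card (pverts (delete_vertex G v))"
    using Suc.hyps(2) v by (simp add: delete_vertex_def)
  then obtain d a b where "strong_rect_rep d (delete_vertex G v) a b"
    using Suc.hyps(1) pair_graph_delete_vertex[OF Suc.prems] by blast
  then show ?case
    by (blast intro: strong_rect_rep_extend[OF Suc.prems v])
qed

text \<open>A representation of least dimension for \<open>P\<close> is converted into one for
  \<open>Q\<close>. It is used with \<open>k = 0\<close> for deleting a vertex and
  \<open>k = 1\<close> for restoring it.\<close>

lemma Least_shift_le:
  fixes P Q :: "nat \<Rightarrow> 'a \<Rightarrow> 'b \<Rightarrow> bool"
  assumes "\<exists>d a b. P d a b" "\<And>d a b. P d a b \<Longrightarrow> \<exists>a' b'. Q (d + k) a' b'"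
  shows "(LEAST d. \<exists>a b. Q d a b) \<le> (LEAST d. \<exists>a b. P d a b) + k"
proof -
  have "\<exists>a b. P (LEAST d. \<exists>a b. P d a b) a b"
    by (rule LeastI_ex) (fact assms(1))
  then obtain a b where "P (LEAST d. \<exists>a b. P d a b) a b"
    by (elim exE)
  then have "\<exists>a b. Q ((LEAST d. \<exists>a b. P d a b) + k) a b"
    by (rule assms(2))
  then show ?thesis
    by (rule Least_le)
qed

interpretation strong: vertex_stable strong_boxicity
proof
  fix G :: "'v pair_pre_digraph" and v
  assume G: "pair_graph G" and v: "v \<in> pverts G"
  have "strong_boxicity (delete_vertex G v) \<le> strong_boxicity G + 0"
    unfolding strong_boxicity_def
    by (intro Least_shift_le strong_rect_rep_exists G)
      (metis add_0_right strong_rect_rep_delete_vertex)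
  then show "strong_boxicity (delete_vertex G v) \<le> strong_boxicity G"
    by simp
  show "strong_boxicity G \<le> strong_boxicity (delete_vertex G v) + 1"
    unfolding strong_boxicity_def
    by (intro Least_shift_le strong_rect_rep_exists pair_graph_delete_vertex G)
      (metis Suc_eq_plus1 strong_rect_rep_extend[OF G v])
qed

interpretation weak: vertex_stable boxicity
proof
  fix G :: "'v pair_pre_digraph" and v
  assume G: "pair_graph G" and v: "v \<in> pverts G"
  have exists: "\<exists>d a b. rect_rep d H a b" if "pair_graph H" for H :: "'v pair_pre_digraph"
    using strong_rect_rep_exists[OF that] unfolding strong_rect_rep_def by blast
  have "boxicity (delete_vertex G v) \<le> boxicity G + 0"
    unfolding boxicity_def
    by (intro Least_shift_le exists G) (metis add_0_right rect_rep_delete_vertex)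
  then show "boxicity (delete_vertex G v) \<le> boxicity G"
    by simp
  show "boxicity G \<le> boxicity (delete_vertex G v) + 1"
    unfolding boxicity_def
    by (intro Least_shift_le exists pair_graph_delete_vertex G)
      (metis Suc_eq_plus1 rect_rep_extend[OF G v])
qed

theorem theorem1:
  fixes G :: "'v pair_pre_digraph"
  assumes "pair_graph G"
  shows
    "(\<forall>H \<alpha>\<^sub>v \<alpha>\<^sub>e. reduces_to G \<alpha>\<^sub>v \<alpha>\<^sub>e 0 H \<longrightarrow>
        int (strong_boxicity H) - int \<alpha>\<^sub>e \<le> int (strong_boxicity G) \<and>
        strong_boxicity G \<le> strong_boxicity H + \<alpha>\<^sub>v + \<alpha>\<^sub>e) \<and>
     (\<forall>F \<beta>\<^sub>v \<beta>\<^sub>e \<beta>\<^sub>c. reduces_to G \<beta>\<^sub>v \<beta>\<^sub>e \<beta>\<^sub>c F \<longrightarrow>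
        strong_boxicity G \<le> strong_boxicity F + \<beta>\<^sub>v + \<beta>\<^sub>e + 2 * \<beta>\<^sub>c) \<and>
     (\<forall>H \<alpha>\<^sub>v \<alpha>\<^sub>e. reduces_to G \<alpha>\<^sub>v \<alpha>\<^sub>e 0 H \<longrightarrow>
        int (boxicity H) - int \<alpha>\<^sub>e \<le> int (boxicity G) \<and>
        boxicity G \<le> boxicity H + \<alpha>\<^sub>v + \<alpha>\<^sub>e) \<and>
     (\<forall>F \<beta>\<^sub>v \<beta>\<^sub>e \<beta>\<^sub>c. reduces_to G \<beta>\<^sub>v \<beta>\<^sub>e \<beta>\<^sub>c F \<longrightarrow>
        boxicity G \<le> boxicity F + \<beta>\<^sub>v + \<beta>\<^sub>e + 2 * \<beta>\<^sub>c)"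
proof (intro conjI allI impI)
  fix H k l
  assume H: "reduces_to G k l 0 H"
  \<comment> \<open>Over the integers the subtraction is not truncated, so this is the additive
    bound on naturals rearranged.\<close>
  show "int (strong_boxicity H) - int l \<le> int (strong_boxicity G)"
    using strong.reduces_to_lower[OF H assms] by simp
  show "strong_boxicity G \<le> strong_boxicity H + k + l"
    using strong.reduces_to_upper[OF H assms] by simp
  show "int (boxicity H) - int l \<le> int (boxicity G)"
    using weak.reduces_to_lower[OF H assms] by simp
  show "boxicity G \<le> boxicity H + k + l"
    using weak.reduces_to_upper[OF H assms] by simp
next
  fix F k l m
  assume F: "reduces_to G k l m F"
  show "strong_boxicity G \<le> strong_boxicity F + k + l + 2 * m"
    by (rule strong.reduces_to_upper[OF F assms])
  show "boxicity G \<le> boxicity F + k + l + 2 * m"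
    by (rule weak.reduces_to_upper[OF F assms])
qed

end
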